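(* Let $G$ be a connected edge-coloured multigraph such that $G'$ is non-empty, and let $G^*$ be its P-gadget graph, built from an arbitrary choice of P-gadgets $G_x$, $x\in V(G')$. Then, for every nonnegative integer $r$, $G$ has a PC cycle subgraph with $r$ edges if and only if $G^*$ has a perfect matching with exactly $r$ edges in $E_2$.
   Context: An edge-coloured multigraph is an undirected multigraph (no loops) in which each edge $e$ has a colour $\chi(e)\in\{1,\dots,c\}$, and no two parallel edges have the same colour. For a vertex $x$, $\chi(x)$ denotes the set of colours of edges incident with $x$. A path or cycle is properly coloured (PC) if every two adjacent (consecutive) edges of it have different colours; a pair of parallel edges of different colours is regarded as a cycle of length 2. A cycle subgraph of $G$ is a vertex-disjoint union of cycles of $G$ (cycles of length 2 allowed); it is PC if each of its cycles is PC. Let $G'=G-\{x\in V(G): |\chi(x)|=1\}$. For each $x\in V(G')$, a P-gadget $G_x$ is an (uncoloured, simple) graph satisfying: (P1) $\{x_q: q\in\chi(x)\}\subseteq V(G_x)$; (P2) $G_x$ has a perfect matching; (P3) for each $p\neq q\in\chi(x)$, if $G_x-\{x_p,x_q\}$ is non-empty then it has a perfect matching; (P4) for each $L\subseteq\chi(x)$ with $|L|\ge 3$, if $G_x-\{x_l: l\in L\}$ is non-empty then it has no perfect matching. The gadgets for distinct vertices are vertex-disjoint. The P-gadget graph $G^*$ has vertex set $\bigcup_{x\in V(G')}V(G_x)$ and edge set $E_1\cup E_2$, where $E_1=\bigcup_{x\in V(G')}E(G_x)$ and $E_2=\{y_qz_q: y,z\in V(G'),\ yz\in E(G),\ \chi(yz)=q\}$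 (one edge $y_qz_q$ for each edge $yz$ of $G$ of colour $q$ between vertices of $G'$).
   Formalization: Extra hypothesis: if |χ(x)| ≥ 3, then G_x − {x_q : q ∈ χ(x)} is non-empty (this excludes only K_4 on four x_q's); without it the claim fails for two vertices joined by four parallel edges of distinct colours with r = 4. *)

theory Defs
  imports Main
begin

record ('v, 'e) cmgraph =
  mverts :: "'v set"
  medges :: "'e set"
  ends :: "'e \<Rightarrow> 'v set"
  colour :: "'e \<Rightarrow> nat"

text \<open>The injectivity condition says that no two parallel edges have the same colour.\<close>

definition edge_coloured_multigraph :: "nat \<Rightarrow> ('v, 'e) cmgraph \<Rightarrow> bool" where
  "edge_coloured_multigraph c G \<longleftrightarrow>
     finite (mverts G) \<and> finite (medges G) \<and>
     (\<forall>e\<in>medges G. ends G e \<subseteq> mverts G \<and> card (ends G e) = 2 \<and> colour G e \<in> {1..c}) \<and>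
     inj_on (\<lambda>e. (ends G e, colour G e)) (medges G)"

definition mconnected :: "('v, 'e) cmgraph \<Rightarrow> bool" where
  "mconnected G \<longleftrightarrow>
     (\<forall>u\<in>mverts G. \<forall>v\<in>mverts G. (u, v) \<in> {(a, b). \<exists>e\<in>medges G. ends G e = {a, b}}\<^sup>*)"

definition colours_at :: "('v, 'e) cmgraph \<Rightarrow> 'v \<Rightarrow> nat set" where
  "colours_at G x = colour G ` {e \<in> medges G. x \<in> ends G e}"

definition mdelete :: "('v, 'e) cmgraph \<Rightarrow> 'v set \<Rightarrow> ('v, 'e) cmgraph" where
  "mdelete G S = G\<lparr>mverts := mverts G - S, medges := {e \<in> medges G. ends G e \<inter> S = {}}\<rparr>"

text \<open>The graph \<open>G'\<close>. The colour sets refer to the original graph \<open>G\<close>.\<close>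

definition reduced :: "('v, 'e) cmgraph \<Rightarrow> ('v, 'e) cmgraph" where
  "reduced G = mdelete G {x \<in> mverts G. card (colours_at G x) = 1}"

text \<open>
  A subgraph of a multigraph is given by its vertex set and its edge set.
  Distinctness of the edges only matters for cycles of length 2.
\<close>

definition is_cycle :: "('v, 'e) cmgraph \<Rightarrow> 'v set \<times> 'e set \<Rightarrow> bool" where
  "is_cycle G C \<longleftrightarrow>
     (\<exists>vs es. length vs = length es \<and> 2 \<le> length vs \<and> distinct vs \<and> distinct es \<and>
        set vs \<subseteq> mverts G \<and> set es \<subseteq> medges G \<and>
        (\<forall>i<length vs. ends G (es ! i) = {vs ! i, vs ! (Suc i mod length vs)}) \<and>
        C = (set vs, set es))"

definition properly_coloured :: "('v, 'e) cmgraph \<Rightarrow> 'v set \<times> 'e set \<Rightarrow> bool" where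
  "properly_coloured G C \<longleftrightarrow>
     (\<forall>e\<in>snd C. \<forall>f\<in>snd C. e \<noteq> f \<and> ends G e \<inter> ends G f \<noteq> {} \<longrightarrow> colour G e \<noteq> colour G f)"

text \<open>The union may be empty, so the empty subgraph is a cycle subgraph with 0 edges.\<close>

definition pc_cycle_subgraph :: "('v, 'e) cmgraph \<Rightarrow> 'v set \<times> 'e set \<Rightarrow> bool" where
  "pc_cycle_subgraph G H \<longleftrightarrow>
     (\<exists>\<C>. (\<forall>C\<in>\<C>. is_cycle G C \<and> properly_coloured G C) \<and>
          pairwise (\<lambda>C D. fst C \<inter> fst D = {}) \<C> \<and>
          H = (\<Union>(fst ` \<C>), \<Union>(snd ` \<C>)))"

record 'w sgraph =
  sverts :: "'w set"
  sedges :: "'w set set"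

definition simple_graph :: "'w sgraph \<Rightarrow> bool" where
  "simple_graph H \<longleftrightarrow> finite (sverts H) \<and> (\<forall>e\<in>sedges H. e \<subseteq> sverts H \<and> card e = 2)"

definition sdelete :: "'w sgraph \<Rightarrow> 'w set \<Rightarrow> 'w sgraph" where
  "sdelete H S = \<lparr>sverts = sverts H - S, sedges = {e \<in> sedges H. e \<inter> S = {}}\<rparr>"

definition perfect_matching :: "'w sgraph \<Rightarrow> 'w set set \<Rightarrow> bool" where
  "perfect_matching H M \<longleftrightarrow> M \<subseteq> sedges H \<and> pairwise disjnt M \<and> \<Union>M = sverts H"

text \<open>
  Here \<open>K\<close> is the colour set \<open>\<chi>(x)\<close> and \<open>port q\<close> is the vertex \<open>x\<^sub>q\<close>.
\<close>

definition P_gadget :: "nat set \<Rightarrow> (nat \<Rightarrow> 'w) \<Rightarrow> 'w sgraph \<Rightarrow> bool" where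
  "P_gadget K port H \<longleftrightarrow>
     simple_graph H \<and> inj_on port K \<and>
     port ` K \<subseteq> sverts H \<and>
     (\<exists>M. perfect_matching H M) \<and>
     (\<forall>p\<in>K. \<forall>q\<in>K. p \<noteq> q \<longrightarrow> sverts (sdelete H {port p, port q}) \<noteq> {} \<longrightarrow>
        (\<exists>M. perfect_matching (sdelete H {port p, port q}) M)) \<and>
     (\<forall>L\<subseteq>K. 3 \<le> card L \<longrightarrow> sverts (sdelete H (port ` L)) \<noteq> {} \<longrightarrow>
        \<not> (\<exists>M. perfect_matching (sdelete H (port ` L)) M))"

definition gadget_choice ::
  "('v, 'e) cmgraph \<Rightarrow> ('v \<Rightarrow> nat \<Rightarrow> 'w) \<Rightarrow> ('v \<Rightarrow> 'w sgraph) \<Rightarrow> bool" where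
  "gadget_choice G port H \<longleftrightarrow>
     (\<forall>x\<in>mverts (reduced G). P_gadget (colours_at G x) (port x) (H x)) \<and>
     (\<forall>x\<in>mverts (reduced G). \<forall>y\<in>mverts (reduced G). x \<noteq> y \<longrightarrow> sverts (H x) \<inter> sverts (H y) = {})"

definition E1 :: "('v, 'e) cmgraph \<Rightarrow> ('v \<Rightarrow> 'w sgraph) \<Rightarrow> 'w set set" where
  "E1 G H = (\<Union>x\<in>mverts (reduced G). sedges (H x))"

definition E2 :: "('v, 'e) cmgraph \<Rightarrow> ('v \<Rightarrow> nat \<Rightarrow> 'w) \<Rightarrow> 'w set set" where
  "E2 G port = {{port y q, port z q} | y z q.
     y \<in> mverts (reduced G) \<and> z \<in> mverts (reduced G) \<and>
     (\<exists>e\<in>medges G. ends G e = {y, z} \<and> colour G e = q)}"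

definition gadget_graph ::
  "('v, 'e) cmgraph \<Rightarrow> ('v \<Rightarrow> nat \<Rightarrow> 'w) \<Rightarrow> ('v \<Rightarrow> 'w sgraph) \<Rightarrow> 'w sgraph" where
  "gadget_graph G port H =
     \<lparr>sverts = (\<Union>x\<in>mverts (reduced G). sverts (H x)), sedges = E1 G H \<union> E2 G port\<rparr>"

text \<open>
  The last gadget condition says nothing about a set \<open>L\<close> whose deletion leaves no vertex. This
  allows \<open>K\<^sub>4\<close> on \<open>x\<^sub>1, x\<^sub>2, x\<^sub>3, x\<^sub>4\<close> as a gadget, and then all four of its vertices can be matched
  outside the gadget: for two vertices joined by four edges of distinct colours, the gadget graph
  has a perfect matching with 4 edges in \<open>E\<^sub>2\<close>, but a PC cycle subgraph has at most 2 edges.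
  The following condition excludes exactly this degenerate case.
\<close>

definition nondegenerate ::
  "('v, 'e) cmgraph \<Rightarrow> ('v \<Rightarrow> nat \<Rightarrow> 'w) \<Rightarrow> ('v \<Rightarrow> 'w sgraph) \<Rightarrow> bool" where
  "nondegenerate G port H \<longleftrightarrow>
     (\<forall>x\<in>mverts (reduced G). 3 \<le> card (colours_at G x) \<longrightarrow>
        sverts (sdelete (H x) (port x ` colours_at G x)) \<noteq> {})"

end

theory Submission
  imports Defs
begin

text \<open>
  Both sides are compared with edge sets \<open>F\<close> in which every vertex of \<open>G\<close> has degree 0 or 2, with
  different colours in the latter case. Such sets are exactly the edge sets of PC cycle subgraphs:
  a cycle is closed off at the end of a longest path in \<open>F\<close>, and its removal leaves a set of the
  same kind that avoids its vertices. A perfect matching of the gadget graph meets \<open>E\<^sub>2\<close> in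
  the copies of the edges of a set \<open>F\<close>, and it restricts to a perfect matching of each gadget minus
  the ports used by \<open>F\<close>. The number of these ports is even since the gadget itself has a perfect
  matching, and it is less than 3 by (P4), so it is 0 or 2. Conversely, (P2) and (P3) match the
  remaining vertices of each gadget.
\<close>

definition edges_at :: "('v, 'e) cmgraph \<Rightarrow> 'e set \<Rightarrow> 'v \<Rightarrow> 'e set" where
  "edges_at G F x = {e \<in> F. x \<in> ends G e}"

text \<open>Degree 0 is allowed, so unlike an ordinary 2-factor the edge set need not span. It is
  written as emptiness because \<open>card\<close> of an infinite set is 0 as well.\<close>

definition alternating_2_factor :: "('v, 'e) cmgraph \<Rightarrow> 'e set \<Rightarrow> bool" where
  "alternating_2_factor G F \<longleftrightarrow>
     F \<subseteq> medges G \<and>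
     (\<forall>x\<in>mverts G. (edges_at G F x = {} \<or> card (edges_at G F x) = 2) \<and>
        inj_on (colour G) (edges_at G F x))"

section \<open>Cycle subgraphs and edge degrees\<close>

lemma is_cycle_ends_subset:
  assumes "is_cycle G C" "e \<in> snd C"
  shows "ends G e \<subseteq> fst C"
proof -
  obtain vs es where c: "length vs = length es" "2 \<le> length vs" "C = (set vs, set es)"
    "\<forall>i<length vs. ends G (es ! i) = {vs ! i, vs ! (Suc i mod length vs)}"
    using assms(1) unfolding is_cycle_def by blast
  obtain i where i: "i < length vs" "e = es ! i"
    using assms(2) c(1,3) by (auto simp: in_set_conv_nth)
  have "Suc i mod length vs < length vs" using c(2) by (intro mod_less_divisor) linarith
  with c i show ?thesis by auto
qed

lemma is_cycle_subset:
  assumes "is_cycle G C"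
  shows "fst C \<subseteq> mverts G" "snd C \<subseteq> medges G"
  using assms unfolding is_cycle_def by auto

text \<open>Computes the cyclic predecessor of \<open>i\<close>, which gives the second edge at a
  vertex of a cycle.\<close>

lemma Suc_mod_eq_iff:
  fixes n :: nat
  assumes "i < n" "j < n"
  shows "Suc j mod n = i \<longleftrightarrow> j = (if i = 0 then n - 1 else i - 1)"
  using assms by (cases "Suc j = n") auto

lemma is_cycle_degree:
  assumes "is_cycle G C" "x \<in> fst C"
  shows "card (edges_at G (snd C) x) = 2"
proof -
  obtain vs es where c: "length vs = length es" "2 \<le> length vs" "C = (set vs, set es)"
    "distinct vs" "distinct es"
    "\<forall>i<length vs. ends G (es ! i) = {vs ! i, vs ! (Suc i mod length vs)}"
    using assms(1) unfolding is_cycle_def by blast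
  let ?n = "length vs"
  obtain i where i: "i < ?n" "x = vs ! i"
    using assms(2) c(3) by (auto simp: in_set_conv_nth)
  \<comment> \<open>The edge with index \<open>i\<close> leaves \<open>x\<close>, and the one with
    the cyclically preceding index \<open>?k\<close> enters it.\<close>
  let ?k = "if i = 0 then ?n - 1 else i - 1"
  have k: "?k < ?n" "?k \<noteq> i" using i c(2) by auto
  have inc: "x \<in> ends G (es ! j) \<longleftrightarrow> j = i \<or> j = ?k" if j: "j < ?n" for j
  proof -
    have m: "Suc j mod ?n < ?n" using c(2) by (intro mod_less_divisor) linarith
    have "x \<in> ends G (es ! j) \<longleftrightarrow> vs ! i = vs ! j \<or> vs ! i = vs ! (Suc j mod ?n)"
      using c(6) j i by auto
    also have "\<dots> \<longleftrightarrow> i = j \<or> i = Suc j mod ?n"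
      using c(4) i j m by (simp add: nth_eq_iff_index_eq)
    also have "\<dots> \<longleftrightarrow> j = i \<or> j = ?k" using Suc_mod_eq_iff[OF i(1) j] by auto
    finally show ?thesis .
  qed
  have "edges_at G (snd C) x = {es ! i, es ! ?k}"
  proof
    show "edges_at G (snd C) x \<subseteq> {es ! i, es ! ?k}"
      using inc c(1,3) by (auto simp: edges_at_def in_set_conv_nth)
    show "{es ! i, es ! ?k} \<subseteq> edges_at G (snd C) x"
      using inc[OF i(1)] inc[OF k(1)] i(1) k(1) c(1,3) by (simp add: edges_at_def)
  qed
  \<comment> \<open>In a cycle of length 2 both edges have the same ends, so only
    \<open>distinct es\<close> separates them.\<close>
  moreover have "es ! i \<noteq> es ! ?k"
    using nth_eq_iff_index_eq[OF c(5), of i ?k] c(1) i(1) k by auto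
  ultimately show ?thesis by simp
qed

text \<open>By vertex-disjointness all edges at \<open>x\<close> come from the one cycle through
  \<open>x\<close>. There are two of them, and they share \<open>x\<close>, so their colours
  differ.\<close>

lemma pc_cycle_subgraph_alternating:
  assumes "pc_cycle_subgraph G C"
  shows "alternating_2_factor G (snd C)"
proof -
  obtain \<C> where C: "\<forall>D\<in>\<C>. is_cycle G D \<and> properly_coloured G D"
    "pairwise (\<lambda>C D. fst C \<inter> fst D = {}) \<C>" "C = (\<Union>(fst ` \<C>), \<Union>(snd ` \<C>))"
    using assms unfolding pc_cycle_subgraph_def by blast
  show ?thesis unfolding alternating_2_factor_def
  proof (intro conjI ballI)
    show "snd C \<subseteq> medges G" using C is_cycle_subset(2) by fastforce
  next
    fix x
    have "(edges_at G (snd C) x = {} \<or> card (edges_at G (snd C) x) = 2) \<and>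
        inj_on (colour G) (edges_at G (snd C) x)"
    proof (cases "\<exists>D\<in>\<C>. x \<in> fst D")
      case False
      then have "edges_at G (snd C) x = {}"
        using C is_cycle_ends_subset by (fastforce simp: edges_at_def)
      then show ?thesis by simp
    next
      case True
      then obtain D where D: "D \<in> \<C>" "x \<in> fst D" by blast
      have uniq: "D' = D" if "D' \<in> \<C>" "x \<in> fst D'" for D'
        using C(2) D that unfolding pairwise_def by blast
      have "edges_at G (snd C) x = edges_at G (snd D) x"
      proof
        show "edges_at G (snd C) x \<subseteq> edges_at G (snd D) x"
        proof
          fix e assume e: "e \<in> edges_at G (snd C) x"
          then obtain D' where D': "D' \<in> \<C>" "e \<in> snd D'" "x \<in> ends G e"
            using C(3) by (auto simp: edges_at_def)
          then have "x \<in> fst D'" using C(1) is_cycle_ends_subset[of G D' e] by auto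
          with uniq D' show "e \<in> edges_at G (snd D) x" by (auto simp: edges_at_def)
        qed
        show "edges_at G (snd D) x \<subseteq> edges_at G (snd C) x"
          using C(3) D(1) by (auto simp: edges_at_def)
      qed
      moreover have "inj_on (colour G) (edges_at G (snd D) x)"
        using C(1) D(1) unfolding properly_coloured_def inj_on_def edges_at_def by blast
      ultimately show ?thesis using is_cycle_degree C(1) D by metis
    qed
    then show "edges_at G (snd C) x = {} \<or> card (edges_at G (snd C) x) = 2"
      "inj_on (colour G) (edges_at G (snd C) x)" by blast+
  qed
qed

section \<open>Paths and the decomposition into cycles\<close>

definition edge_path :: "('v, 'e) cmgraph \<Rightarrow> 'e set \<Rightarrow> 'v list \<Rightarrow> 'e list \<Rightarrow> bool" where
  "edge_path G F vs es \<longleftrightarrow>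
     length vs = Suc (length es) \<and> es \<noteq> [] \<and> distinct vs \<and> set vs \<subseteq> mverts G \<and> set es \<subseteq> F \<and>
     (\<forall>i<length es. ends G (es ! i) = {vs ! i, vs ! Suc i})"

lemma edge_path_ConsI:
  assumes "edge_path G F vs es" "f \<in> F" "ends G f = {w, hd vs}" "w \<in> mverts G" "w \<notin> set vs"
  shows "edge_path G F (w # vs) (f # es)"
  using assms unfolding edge_path_def
  by (cases vs) (auto simp: nth_Cons split: nat.split)

text \<open>Equal edges have equal end pairs. As the vertices are distinct, two pairs of consecutive
  vertices agree only at the same position.\<close>

lemma edge_path_distinct_edges:
  assumes "edge_path G F vs es"
  shows "distinct es"
  unfolding distinct_conv_nth
proof (intro allI impI notI)
  fix i j assume ij: "i < length es" "j < length es" "i \<noteq> j" "es ! i = es ! j"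
  then have "{vs ! i, vs ! Suc i} = {vs ! j, vs ! Suc j}"
    using assms unfolding edge_path_def by metis
  then show False using ij assms unfolding edge_path_def
    by (auto simp: doubleton_eq_iff nth_eq_iff_index_eq)
qed

lemma ends_doubleton:
  assumes "edge_coloured_multigraph c G" "e \<in> medges G" "x \<in> ends G e"
  obtains y where "ends G e = {x, y}" "y \<noteq> x" "x \<in> mverts G" "y \<in> mverts G"
proof -
  have "card (ends G e) = 2" "ends G e \<subseteq> mverts G"
    using assms(1,2) unfolding edge_coloured_multigraph_def by auto
  moreover from this assms(3) obtain y where "ends G e = {x, y}" "y \<noteq> x"
    unfolding card_2_iff by (metis insertE insert_commute singletonD)
  ultimately show thesis using that by auto
qed

text \<open>The next edge at the head of a longest path must return to the path.\<close>

lemma exists_cycle: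
  assumes G: "edge_coloured_multigraph c G"
    and F: "F \<subseteq> medges G" "F \<noteq> {}"
    and deg: "\<And>x e. e \<in> F \<Longrightarrow> x \<in> ends G e \<Longrightarrow> \<exists>f\<in>F. f \<noteq> e \<and> x \<in> ends G f"
  shows "\<exists>C. is_cycle G C \<and> snd C \<subseteq> F \<and> snd C \<noteq> {}"
proof -
  have fin: "finite (mverts G)" using G unfolding edge_coloured_multigraph_def by simp
  obtain e where e: "e \<in> F" using F by blast
  have eG: "e \<in> medges G" using e F by blast
  have "card (ends G e) = 2" using G eG unfolding edge_coloured_multigraph_def by simp
  then obtain a where "a \<in> ends G e" by (auto simp: card_2_iff)
  from ends_doubleton[OF G eG this]
  obtain b where ab: "ends G e = {a, b}" "b \<noteq> a" "a \<in> mverts G" "b \<in> mverts G" .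
  \<comment> \<open>\<open>P n\<close> says that \<open>F\<close> contains a path with
    \<open>n\<close> edges. Its \<open>n + 1\<close> vertices are distinct, so \<open>n\<close> is
    bounded and a longest path exists.\<close>
  define P where "P n \<longleftrightarrow> (\<exists>vs es. edge_path G F vs es \<and> length es = n)" for n
  have "edge_path G F [a, b] [e]" using ab e unfolding edge_path_def by auto
  then have "P 1" unfolding P_def by fastforce
  moreover have "n \<le> card (mverts G)" if Pn: "P n" for n
  proof -
    obtain vs es where p: "edge_path G F vs es" "length es = n" using Pn unfolding P_def by blast
    then have "length vs = card (set vs)" unfolding edge_path_def by (simp add: distinct_card)
    also have "\<dots> \<le> card (mverts G)"
      using p fin unfolding edge_path_def by (simp add: card_mono)
    finally show ?thesis using p unfolding edge_path_def by simp
  qed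
  ultimately obtain n where n: "P n" "\<And>m. P m \<Longrightarrow> m \<le> n"
    using Nat.ex_has_greatest_nat[of P 1 "card (mverts G)"] by auto
  obtain vs es where p: "edge_path G F vs es" "length es = n" using n(1) unfolding P_def by blast
  note p' = p(1)[unfolded edge_path_def]
  have hd: "hd vs = vs ! 0" using p' by (cases vs) auto
  have e0: "es ! 0 \<in> F" "ends G (es ! 0) = {vs ! 0, vs ! 1}" using p' by auto
  \<comment> \<open>A second edge at the first vertex of the path; its other end \<open>w\<close>
    cannot be new, as the path would become longer.\<close>
  then obtain f where f: "f \<in> F" "f \<noteq> es ! 0" "vs ! 0 \<in> ends G f" using deg by blast
  have fG: "f \<in> medges G" using f F by blast
  from ends_doubleton[OF G fG f(3)]
  obtain w where w: "ends G f = {vs ! 0, w}" "w \<noteq> vs ! 0" "w \<in> mverts G" .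
  have "w \<in> set vs"
  proof (rule ccontr)
    assume "w \<notin> set vs"
    then have "edge_path G F (w # vs) (f # es)"
      using edge_path_ConsI[OF p(1) f(1) _ w(3)] w hd by (metis insert_commute)
    then have "P (Suc n)" using p(2) unfolding P_def by fastforce
    then show False using n(2) by fastforce
  qed
  then obtain i where i: "i < length vs" "vs ! i = w" by (auto simp: in_set_conv_nth)
  have i0: "0 < i" "i \<le> length es" using i w p' by (auto intro: gr0I)
  \<comment> \<open>The only path edge at \<open>vs ! 0\<close> is \<open>es ! 0\<close>, from which
    \<open>f\<close> differs.\<close>
  have fes: "f \<notin> set es"
  proof
    assume "f \<in> set es"
    then obtain j where j: "j < length es" "f = es ! j" by (auto simp: in_set_conv_nth)
    then have "ends G f = {vs ! j, vs ! Suc j}" using p' by blast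
    then have "vs ! 0 = vs ! j \<or> vs ! 0 = vs ! Suc j" using f(3) by auto
    then have "j = 0" using p' j by (auto simp: nth_eq_iff_index_eq)
    then show False using f(2) j by simp
  qed
  \<comment> \<open>The cycle is the initial segment of the path up to \<open>w = vs ! i\<close>,
    closed by \<open>f\<close>. For \<open>i = 1\<close> it consists of the parallel edges
    \<open>es ! 0\<close> and \<open>f\<close>.\<close>
  let ?vs = "take (Suc i) vs" and ?es = "take i es @ [f]"
  have "is_cycle G (set ?vs, set ?es)"
    unfolding is_cycle_def
  proof (rule exI[of _ ?vs], rule exI[of _ ?es], intro conjI)
    show "length ?vs = length ?es" "2 \<le> length ?vs" using i i0 by auto
    show "distinct ?vs" using p' by simp
    show "distinct ?es" using edge_path_distinct_edges[OF p(1)] fes by (auto dest: in_set_takeD)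
    show "set ?vs \<subseteq> mverts G" using p' by (auto dest: in_set_takeD)
    show "set ?es \<subseteq> medges G" using p' f F by (auto dest: in_set_takeD)
    show "\<forall>j<length ?vs. ends G (?es ! j) = {?vs ! j, ?vs ! (Suc j mod length ?vs)}"
    proof (intro allI impI)
      fix j assume "j < length ?vs"
      then have j: "j < i \<or> j = i" using i by auto
      have l: "length ?vs = Suc i" using i by auto
      from j show "ends G (?es ! j) = {?vs ! j, ?vs ! (Suc j mod length ?vs)}"
      proof
        assume "j < i"
        then show ?thesis using l i0 p' by (simp add: nth_append)
      next
        assume "j = i"
        then show ?thesis using l i i0 w by (auto simp: nth_append)
      qed
    qed
  qed simp
  moreover have "set ?es \<subseteq> F" using p' f by (auto dest: in_set_takeD)
  ultimately show ?thesis by (intro exI[of _ "(set ?vs, set ?es)"]) simp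
qed

text \<open>Induction on the finite set \<open>F\<close>: a cycle is split off, and it uses up every
  edge of \<open>F\<close> at its vertices, so the remainder satisfies the same degree
  condition.\<close>

lemma alternating_2_factor_pc_cycle_subgraph:
  assumes G: "edge_coloured_multigraph c G"
    and "alternating_2_factor G F"
  shows "\<exists>C. pc_cycle_subgraph G C \<and> snd C = F"
proof -
  have fin: "finite F"
    using assms finite_subset unfolding edge_coloured_multigraph_def alternating_2_factor_def by blast
  \<comment> \<open>The last conjunct strengthens the induction: each vertex of the family meets an
    edge of \<open>F\<close>. It makes the cycles of the remainder disjoint from the one split
    off.\<close>
  from this assms(2) have "\<exists>\<C>. (\<forall>C\<in>\<C>. is_cycle G C \<and> properly_coloured G C) \<and>
          pairwise (\<lambda>C D. fst C \<inter> fst D = {}) \<C> \<and> F = \<Union>(snd ` \<C>) \<and>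
          (\<forall>C\<in>\<C>. \<forall>x\<in>fst C. edges_at G F x \<noteq> {})"
  proof (induction F rule: finite_psubset_induct)
    case (psubset F)
    note alt = psubset.prems[unfolded alternating_2_factor_def]
    show ?case
    proof (cases "F = {}")
      case True
      then show ?thesis by (intro exI[of _ "{}"]) simp
    next
      case False
      have FG: "F \<subseteq> medges G" using alt by blast
      have "\<exists>f\<in>F. f \<noteq> e \<and> x \<in> ends G f" if e: "e \<in> F" "x \<in> ends G e" for x e
      proof -
        have "x \<in> mverts G" using ends_doubleton[OF G] e FG by blast
        then have "card (edges_at G F x) = 2" using alt e by (auto simp: edges_at_def)
        then obtain a b where "edges_at G F x = {a, b}" "a \<noteq> b" by (auto simp: card_2_iff)
        then have "a \<in> edges_at G F x" "b \<in> edges_at G F x" "a \<noteq> e \<or> b \<noteq> e" by auto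
        then show ?thesis by (auto simp: edges_at_def)
      qed
      from exists_cycle[OF G FG False this]
      obtain C where C: "is_cycle G C" "snd C \<subseteq> F" "snd C \<noteq> {}" by blast
      \<comment> \<open>Both sets have two elements and one contains the other.\<close>
      have eqC: "edges_at G F x = edges_at G (snd C) x" if x: "x \<in> fst C" for x
      proof -
        have sub: "edges_at G (snd C) x \<subseteq> edges_at G F x" using C(2) by (auto simp: edges_at_def)
        have card: "card (edges_at G (snd C) x) = 2" using is_cycle_degree[OF C(1) x] .
        then have "edges_at G F x \<noteq> {}" using sub by auto
        then have "card (edges_at G F x) = 2" using alt is_cycle_subset(1)[OF C(1)] x by blast
        moreover have "finite (edges_at G F x)" using psubset.hyps by (simp add: edges_at_def)
        ultimately show ?thesis using sub card card_subset_eq by metis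
      qed
      \<comment> \<open>Removing the cycle lowers the degree to 0 on its vertices and changes
        nothing at other vertices.\<close>
      have off: "edges_at G (F - snd C) x = (if x \<in> fst C then {} else edges_at G F x)" for x
      proof (cases "x \<in> fst C")
        case True
        then show ?thesis using eqC[OF True] by (auto simp: edges_at_def)
      next
        case False
        then show ?thesis using is_cycle_ends_subset[OF C(1)] by (auto simp: edges_at_def)
      qed
      have pc: "properly_coloured G C"
        unfolding properly_coloured_def
      proof (intro ballI impI)
        fix e f assume ef: "e \<in> snd C" "f \<in> snd C" "e \<noteq> f \<and> ends G e \<inter> ends G f \<noteq> {}"
        then obtain x where x: "x \<in> ends G e" "x \<in> ends G f" by blast
        have "x \<in> mverts G" using ends_doubleton[OF G] x ef C FG by blast
        then have "inj_on (colour G) (edges_at G F x)" using alt by blast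
        then show "colour G e \<noteq> colour G f"
          using ef x C(2) by (auto simp: inj_on_def edges_at_def)
      qed
      have "F - snd C \<subset> F" using C by blast
      moreover have "alternating_2_factor G (F - snd C)"
        using alt unfolding alternating_2_factor_def off by auto
      ultimately obtain \<C> where IH: "\<forall>C\<in>\<C>. is_cycle G C \<and> properly_coloured G C"
          "pairwise (\<lambda>C D. fst C \<inter> fst D = {}) \<C>" "F - snd C = \<Union>(snd ` \<C>)"
          "\<forall>D\<in>\<C>. \<forall>x\<in>fst D. edges_at G (F - snd C) x \<noteq> {}"
        using psubset.IH[of "F - snd C"] by blast
      \<comment> \<open>A vertex of \<open>D\<close> meets an edge of \<open>F - snd C\<close>,
        whereas by \<open>off\<close> a vertex of \<open>C\<close> meets none.\<close>
      have disj: "fst D \<inter> fst C = {}" if "D \<in> \<C>" for D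
      proof -
        have "x \<notin> fst C" if "x \<in> fst D" for x
          using IH(4) \<open>D \<in> \<C>\<close> that off[of x] by metis
        then show ?thesis by blast
      qed
      have nz: "edges_at G F x \<noteq> {}" if "x \<in> fst C" for x
        using eqC[OF that] is_cycle_degree[OF C(1) that] by auto
      show ?thesis
      proof (intro exI[of _ "insert C \<C>"] conjI)
        show "\<forall>D\<in>insert C \<C>. is_cycle G D \<and> properly_coloured G D" using IH C pc by blast
        show "pairwise (\<lambda>C D. fst C \<inter> fst D = {}) (insert C \<C>)"
          using IH(2) disj unfolding pairwise_insert by (metis inf_commute)
        show "F = \<Union>(snd ` insert C \<C>)" using IH(3) C(2) by auto
        show "\<forall>D\<in>insert C \<C>. \<forall>x\<in>fst D. edges_at G F x \<noteq> {}"
        proof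
          fix D assume "D \<in> insert C \<C>"
          then show "\<forall>x\<in>fst D. edges_at G F x \<noteq> {}"
            using nz IH(4) by (fastforce simp: edges_at_def)
        qed
      qed
    qed
  qed
  then show ?thesis unfolding pc_cycle_subgraph_def by (metis snd_conv)
qed

section \<open>Perfect matchings of the gadget graph\<close>

lemma perfect_matching_even:
  assumes "simple_graph H" "perfect_matching H M"
  shows "even (card (sverts H))"
proof -
  have M: "m \<subseteq> sverts H \<and> card m = 2" if "m \<in> M" for m
    using assms that unfolding simple_graph_def perfect_matching_def by blast
  then have "card (\<Union>M) = sum card M"
    using assms unfolding perfect_matching_def
    by (intro card_Union_disjoint) (auto intro: card_ge_0_finite)
  also have "\<dots> = (\<Sum>m\<in>M. 2)" using M by (intro sum.cong) auto
  finally show ?thesis using assms unfolding perfect_matching_def by simp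
qed

lemma simple_graph_sdelete: "simple_graph H \<Longrightarrow> simple_graph (sdelete H S)"
  unfolding simple_graph_def sdelete_def by auto

text \<open>A perfect matching before and one after the deletion make both orders even, so the
  number of deleted ports is even. (P4) bounds it by 2.\<close>

lemma P_gadget_matching_size:
  assumes P: "P_gadget K port H" and K: "finite K"
    and nd: "3 \<le> card K \<Longrightarrow> sverts (sdelete H (port ` K)) \<noteq> {}"
    and L: "L \<subseteq> K" and M: "perfect_matching (sdelete H (port ` L)) M"
  shows "L = {} \<or> card L = 2"
proof -
  have s: "simple_graph H" "inj_on port K" "port ` K \<subseteq> sverts H"
    and P4: "\<And>L. L \<subseteq> K \<Longrightarrow> 3 \<le> card L \<Longrightarrow> sverts (sdelete H (port ` L)) \<noteq> {} \<Longrightarrow>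
        \<not> (\<exists>M. perfect_matching (sdelete H (port ` L)) M)"
    using P unfolding P_gadget_def by simp_all
  obtain M0 where M0: "perfect_matching H M0" using P unfolding P_gadget_def by blast
  have fin: "finite (sverts H)" using s unfolding simple_graph_def by simp
  have finL: "finite L" using L K finite_subset by blast
  have LH: "port ` L \<subseteq> sverts H" using s(3) L by blast
  have "card L = card (port ` L)"
    using inj_on_subset[OF s(2) L] by (simp add: card_image)
  moreover have "card (port ` L) \<le> card (sverts H)" using LH fin card_mono by blast
  moreover have "card (sverts (sdelete H (port ` L))) = card (sverts H) - card (port ` L)"
    using LH finL by (simp add: sdelete_def card_Diff_subset)
  moreover have "even (card (sverts H))" using perfect_matching_even[OF s(1) M0] .
  moreover have "even (card (sverts (sdelete H (port ` L))))"
    using perfect_matching_even[OF simple_graph_sdelete[OF s(1)] M] .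
  ultimately have ev: "even (card L)" by (simp add: even_diff_nat)
  have "card L < 3"
  proof (rule ccontr)
    assume "\<not> card L < 3"
    then have c: "3 \<le> card L" by simp
    also have "card L \<le> card K" using L K card_mono by blast
    \<comment> \<open>(P4) speaks only of non-empty remainders. A vertex outside all ports of
      \<open>K\<close> also survives the deletion of the ports of \<open>L\<close>.\<close>
    finally have "sverts (sdelete H (port ` K)) \<noteq> {}" using nd by blast
    then have "sverts (sdelete H (port ` L)) \<noteq> {}" using image_mono[OF L, of port] by (auto simp: sdelete_def)
    then show False using P4[OF L c] M by blast
  qed
  then have "card L = 0 \<or> card L = 2" using ev by presburger
  then show ?thesis using finL by simp
qed

lemma P_gadget_matching_exists:
  assumes P: "P_gadget K port H" and L: "L \<subseteq> K" "L = {} \<or> card L = 2"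
  shows "\<exists>M. perfect_matching (sdelete H (port ` L)) M"
proof (cases "L = {}")
  case True
  then have "sdelete H (port ` L) = H" by (simp add: sdelete_def)
  then show ?thesis using P by (simp add: P_gadget_def)
next
  case False
  then obtain p q where pq: "L = {p, q}" "p \<noteq> q" using L(2) by (auto simp: card_2_iff)
  show ?thesis
  proof (cases "sverts (sdelete H {port p, port q}) = {}")
    \<comment> \<open>(P3) is silent when nothing remains; the empty matching is perfect
      there.\<close>
    case True
    then have "perfect_matching (sdelete H (port ` L)) {}"
      using pq by (simp add: perfect_matching_def)
    then show ?thesis by blast
  next
    case False
    then show ?thesis using P pq L(1) unfolding P_gadget_def by simp
  qed
qed

text \<open>The edge \<open>y\<^sub>q z\<^sub>q\<close> that represents an edge \<open>yz\<close> of
  colour \<open>q\<close>. Taking an image of \<open>ends\<close> avoids ordering the two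
  endpoints.\<close>

definition port_edge :: "('v, 'e) cmgraph \<Rightarrow> ('v \<Rightarrow> nat \<Rightarrow> 'w) \<Rightarrow> 'e \<Rightarrow> 'w set" where
  "port_edge G port e = (\<lambda>x. port x (colour G e)) ` ends G e"

section \<open>Ports and the copies of edges in the gadget graph\<close>

locale P_gadget_graph =
  fixes c :: nat and G :: "('v, 'e) cmgraph"
    and port :: "'v \<Rightarrow> nat \<Rightarrow> 'w" and H :: "'v \<Rightarrow> 'w sgraph"
  assumes multigraph: "edge_coloured_multigraph c G"
    and gadgets: "gadget_choice G port H"
    and nondegenerate: "nondegenerate G port H"
begin

abbreviation V where "V \<equiv> mverts (reduced G)"

text \<open>The edges of \<open>G'\<close>, in the form that puts the gadgets of both endpoints at
  hand.\<close>

definition inner_edges :: "'e set" where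
  "inner_edges = {e \<in> medges G. ends G e \<subseteq> V}"

lemma V_iff: "x \<in> V \<longleftrightarrow> x \<in> mverts G \<and> card (colours_at G x) \<noteq> 1"
  by (auto simp: reduced_def mdelete_def)

lemma finite_colours_at: "finite (colours_at G x)"
  using multigraph unfolding edge_coloured_multigraph_def colours_at_def by simp

lemma P_gadget: "x \<in> V \<Longrightarrow> P_gadget (colours_at G x) (port x) (H x)"
  using gadgets unfolding gadget_choice_def by blast

lemma gadget_unique:
  "x \<in> V \<Longrightarrow> y \<in> V \<Longrightarrow> v \<in> sverts (H x) \<Longrightarrow> v \<in> sverts (H y) \<Longrightarrow> x = y"
  using gadgets unfolding gadget_choice_def by blast

lemma colour_in_colours_at: "e \<in> medges G \<Longrightarrow> x \<in> ends G e \<Longrightarrow> colour G e \<in> colours_at G x"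
  unfolding colours_at_def by blast

lemma port_in_gadget: "x \<in> V \<Longrightarrow> q \<in> colours_at G x \<Longrightarrow> port x q \<in> sverts (H x)"
  using P_gadget unfolding P_gadget_def by blast

text \<open>Disjointness of the gadgets recovers the vertex from a port, and injectivity inside a
  gadget recovers the colour.\<close>

lemma port_eq_iff:
  assumes "x \<in> V" "q \<in> colours_at G x" "y \<in> V" "p \<in> colours_at G y"
  shows "port x q = port y p \<longleftrightarrow> x = y \<and> q = p"
proof
  assume eq: "port x q = port y p"
  then have "x = y" using gadget_unique port_in_gadget assms by metis
  moreover have "inj_on (port x) (colours_at G x)" using P_gadget assms(1) unfolding P_gadget_def by blast
  ultimately show "x = y \<and> q = p" using eq assms by (auto dest: inj_onD)
qed auto

lemma port_edge_cases:
  assumes "e \<in> inner_edges" "v \<in> port_edge G port e"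
  obtains x where "x \<in> ends G e" "x \<in> V" "colour G e \<in> colours_at G x" "v = port x (colour G e)"
  using assms colour_in_colours_at unfolding inner_edges_def port_edge_def by blast

lemma port_in_port_edge_iff:
  assumes "e \<in> inner_edges" "x \<in> V" "q \<in> colours_at G x"
  shows "port x q \<in> port_edge G port e \<longleftrightarrow> x \<in> ends G e \<and> colour G e = q"
  using assms port_eq_iff
  by (auto simp: port_edge_def elim!: port_edge_cases[unfolded port_edge_def])

lemma port_edge_in_gadget:
  assumes "e \<in> inner_edges" "v \<in> port_edge G port e" "x \<in> V" "v \<in> sverts (H x)"
  shows "x \<in> ends G e \<and> v = port x (colour G e)"
  using assms gadget_unique port_in_gadget by (metis port_edge_cases)

text \<open>The ports of a copy reveal the endpoints and the colour, and these determine the edge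
  since parallel edges differ in colour. Hence counting in \<open>E2\<close> is counting edges of
  \<open>G\<close>.\<close>

lemma inj_on_port_edge: "inj_on (port_edge G port) inner_edges"
proof (rule inj_onI)
  have sub: "ends G e \<subseteq> ends G f \<and> colour G e = colour G f"
    if ef: "e \<in> inner_edges" "f \<in> inner_edges" "port_edge G port e = port_edge G port f" for e f
  proof -
    have "x \<in> ends G f \<and> colour G f = colour G e" if x: "x \<in> ends G e" for x
    proof -
      have "x \<in> V" "colour G e \<in> colours_at G x"
        using ef x colour_in_colours_at unfolding inner_edges_def by auto
      moreover have "port x (colour G e) \<in> port_edge G port f"
        using ef x unfolding port_edge_def by blast
      ultimately show ?thesis using port_in_port_edge_iff ef by blast
    qed
    \<comment> \<open>The colours are compared at an endpoint, so one must exist.\<close>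
    moreover have "ends G e \<noteq> {}"
      using ef multigraph unfolding inner_edges_def edge_coloured_multigraph_def by fastforce
    ultimately show ?thesis by force
  qed
  fix e f assume "e \<in> inner_edges" "f \<in> inner_edges" "port_edge G port e = port_edge G port f"
  then have "(ends G e, colour G e) = (ends G f, colour G f)" "e \<in> medges G" "f \<in> medges G"
    using sub[of e f] sub[of f e] by (auto simp: inner_edges_def)
  then show "e = f"
    using multigraph unfolding edge_coloured_multigraph_def by (auto dest: inj_onD)
qed

lemma E2_eq: "E2 G port = port_edge G port ` inner_edges"
proof
  show "E2 G port \<subseteq> port_edge G port ` inner_edges"
  proof
    fix m assume "m \<in> E2 G port"
    then obtain y z e where "y \<in> V" "z \<in> V" "e \<in> medges G" "ends G e = {y, z}"
        "m = {port y (colour G e), port z (colour G e)}"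
      unfolding E2_def by blast
    then show "m \<in> port_edge G port ` inner_edges"
      by (intro image_eqI[of _ _ e]) (auto simp: port_edge_def inner_edges_def)
  qed
  show "port_edge G port ` inner_edges \<subseteq> E2 G port"
  proof
    fix m assume "m \<in> port_edge G port ` inner_edges"
    then obtain e where e: "e \<in> medges G" "ends G e \<subseteq> V" "m = port_edge G port e"
      by (auto simp: inner_edges_def)
    then have "card (ends G e) = 2" using multigraph unfolding edge_coloured_multigraph_def by blast
    then obtain y z where "ends G e = {y, z}" by (auto simp: card_2_iff)
    with e show "m \<in> E2 G port" unfolding E2_def port_edge_def by auto
  qed
qed

text \<open>There are no loops, so the two ports lie in different gadgets. This keeps
  \<open>E1\<close> and \<open>E2\<close> apart.\<close>

lemma port_edge_not_in_gadget:
  assumes "e \<in> inner_edges" "x \<in> V"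
  shows "\<not> port_edge G port e \<subseteq> sverts (H x)"
proof
  assume sub: "port_edge G port e \<subseteq> sverts (H x)"
  have e: "e \<in> medges G" "ends G e \<subseteq> V" using assms(1) by (auto simp: inner_edges_def)
  then have "card (ends G e) = 2" using multigraph unfolding edge_coloured_multigraph_def by blast
  then obtain y z where yz: "ends G e = {y, z}" "y \<noteq> z" by (auto simp: card_2_iff)
  have "u = x" if "u \<in> ends G e" for u
  proof -
    have "port u (colour G e) \<in> sverts (H x)" using sub that unfolding port_edge_def by blast
    then show ?thesis
      using gadget_unique port_in_gadget colour_in_colours_at e that assms(2) by blast
  qed
  then show False using yz by blast
qed

lemma gadget_edge:
  assumes "x \<in> V" "m \<in> sedges (H x)"
  shows "m \<subseteq> sverts (H x)" "m \<noteq> {}"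
proof -
  have "simple_graph (H x)" using P_gadget[OF assms(1)] unfolding P_gadget_def by (rule conjunct1)
  then have "m \<subseteq> sverts (H x)" "card m = 2" using assms(2) unfolding simple_graph_def by blast+
  then show "m \<subseteq> sverts (H x)" "m \<noteq> {}" by auto
qed

section \<open>Translation between edge sets and perfect matchings\<close>

lemma matching_of_alternating_2_factor:
  assumes F: "alternating_2_factor G F"
  shows "\<exists>M. perfect_matching (gadget_graph G port H) M \<and> card (M \<inter> E2 G port) = card F"
proof -
  \<comment> \<open>The colours whose ports at \<open>x\<close> are covered by copies of edges of
    \<open>F\<close>; the matching of the gadget must avoid exactly these ports.\<close>
  let ?L = "\<lambda>x. colour G ` edges_at G F x"
  note alt = F[unfolded alternating_2_factor_def]
  have Lsub: "?L x \<subseteq> colours_at G x" for x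
    using alt colour_in_colours_at unfolding edges_at_def by blast
  have Lcard: "?L x = {} \<or> card (?L x) = 2" if "x \<in> mverts G" for x
    using alt that by (auto simp: card_image)
  \<comment> \<open>An endpoint of an edge of \<open>F\<close> sees two colours of \<open>F\<close>,
    so it is not deleted in \<open>G'\<close>.\<close>
  have inner: "F \<subseteq> inner_edges"
  proof
    fix e assume e: "e \<in> F"
    have "x \<in> V" if x: "x \<in> ends G e" for x
    proof -
      have xG: "x \<in> mverts G" using ends_doubleton[OF multigraph] alt e x by blast
      have "?L x \<noteq> {}" using e x by (auto simp: edges_at_def)
      then have "2 \<le> card (colours_at G x)"
        using Lcard[OF xG] card_mono[OF finite_colours_at Lsub] by metis
      then show ?thesis using V_iff xG by simp
    qed
    then show "e \<in> inner_edges" using alt e unfolding inner_edges_def by blast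
  qed
  have "\<forall>x\<in>V. \<exists>M. perfect_matching (sdelete (H x) (port x ` ?L x)) M"
    using P_gadget_matching_exists[OF P_gadget Lsub Lcard] V_iff by blast
  then obtain N where N: "\<And>x. x \<in> V \<Longrightarrow> perfect_matching (sdelete (H x) (port x ` ?L x)) (N x)"
    by metis
  have Nsub: "m \<in> sedges (H x)" "m \<inter> port x ` ?L x = {}" "m \<subseteq> sverts (H x)" "m \<noteq> {}"
    if "x \<in> V" "m \<in> N x" for x m
  proof -
    have "N x \<subseteq> {e \<in> sedges (H x). e \<inter> port x ` ?L x = {}}"
      using N[OF that(1)] unfolding perfect_matching_def sdelete_def by simp
    with that(2) show "m \<in> sedges (H x)" "m \<inter> port x ` ?L x = {}" by blast+
    then show "m \<subseteq> sverts (H x)" "m \<noteq> {}" using gadget_edge[OF that(1)] by blast+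
  qed
  let ?M = "port_edge G port ` F \<union> (\<Union>x\<in>V. N x)"
  \<comment> \<open>A common port would mean a common endpoint and a common colour, against
    injectivity of the colours of \<open>F\<close> at that vertex.\<close>
  have d1: "disjnt (port_edge G port e) (port_edge G port f)" if ef: "e \<in> F" "f \<in> F" "e \<noteq> f" for e f
  proof (rule ccontr)
    assume "\<not> ?thesis"
    then obtain v where v: "v \<in> port_edge G port e" "v \<in> port_edge G port f"
      by (auto simp: disjnt_def)
    then obtain x where x: "x \<in> ends G e" "x \<in> V" "colour G e \<in> colours_at G x" "v = port x (colour G e)"
      using port_edge_cases inner ef by blast
    then have "x \<in> ends G f" "colour G f = colour G e"
      using v port_in_port_edge_iff inner ef by blast+
    moreover have "inj_on (colour G) (edges_at G F x)" using alt x(2) V_iff by blast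
    ultimately show False using ef x(1) by (auto simp: inj_on_def edges_at_def)
  qed
  have d2: "disjnt (port_edge G port e) m" if em: "e \<in> F" "x \<in> V" "m \<in> N x" for e x m
  proof (rule ccontr)
    assume "\<not> ?thesis"
    then obtain v where v: "v \<in> port_edge G port e" "v \<in> m" by (auto simp: disjnt_def)
    then have "x \<in> ends G e \<and> v = port x (colour G e)"
      using port_edge_in_gadget inner em Nsub(3) by blast
    then show False using v(2) em Nsub(2)[OF em(2,3)] by (auto simp: edges_at_def)
  qed
  have d3: "disjnt m m'" if "x \<in> V" "m \<in> N x" "y \<in> V" "m' \<in> N y" "m \<noteq> m'" for x y m m'
  proof (cases "x = y")
    case True
    then show ?thesis
      using N[OF that(1)] that unfolding perfect_matching_def by (auto dest: pairwiseD)
  next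
    case False
    then show ?thesis using gadget_unique Nsub(3) that unfolding disjnt_def by blast
  qed
  have "perfect_matching (gadget_graph G port H) ?M"
    unfolding perfect_matching_def
  proof (intro conjI)
    show "?M \<subseteq> sedges (gadget_graph G port H)"
      using Nsub(1) inner unfolding gadget_graph_def E1_def E2_eq by auto
    show "pairwise disjnt ?M"
    proof (rule pairwiseI)
      fix m m' assume "m \<in> ?M" "m' \<in> ?M" "m \<noteq> m'"
      then consider
          e f where "e \<in> F" "f \<in> F" "e \<noteq> f" "m = port_edge G port e" "m' = port_edge G port f"
        | e x where "e \<in> F" "x \<in> V" "m = port_edge G port e" "m' \<in> N x"
        | e x where "e \<in> F" "x \<in> V" "m' = port_edge G port e" "m \<in> N x"
        | x y where "x \<in> V" "m \<in> N x" "y \<in> V" "m' \<in> N y" "m \<noteq> m'"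
        by blast
      then show "disjnt m m'" using d1 d2 d3 by cases (metis disjnt_sym)+
    qed
    show "\<Union>?M = sverts (gadget_graph G port H)"
    proof
      have "port_edge G port e \<subseteq> (\<Union>x\<in>V. sverts (H x))" if "e \<in> F" for e
        using that inner port_in_gadget by (blast elim: port_edge_cases)
      then have "\<Union>?M \<subseteq> (\<Union>x\<in>V. sverts (H x))" using Nsub(3) by fast
      then show "\<Union>?M \<subseteq> sverts (gadget_graph G port H)" by (simp add: gadget_graph_def)
      show "sverts (gadget_graph G port H) \<subseteq> \<Union>?M"
      proof
        fix v assume "v \<in> sverts (gadget_graph G port H)"
        then obtain x where x: "x \<in> V" "v \<in> sverts (H x)" unfolding gadget_graph_def by auto
        show "v \<in> \<Union>?M"
        proof (cases "v \<in> port x ` ?L x")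
          case True
          then obtain e where "e \<in> F" "x \<in> ends G e" "v = port x (colour G e)"
            by (auto simp: edges_at_def)
          then show ?thesis unfolding port_edge_def by blast
        next
          case False
          then have "v \<in> \<Union>(N x)" using N[OF x(1)] x(2) unfolding perfect_matching_def sdelete_def by auto
          then show ?thesis using x(1) by blast
        qed
      qed
    qed
  qed
  \<comment> \<open>Each edge of \<open>N x\<close> stays within one gadget, which no edge of
    \<open>E2\<close> does.\<close>
  moreover have "?M \<inter> E2 G port = port_edge G port ` F"
    using inner port_edge_not_in_gadget Nsub(3) unfolding E2_eq by blast
  moreover have "card (port_edge G port ` F) = card F"
    using inj_on_subset[OF inj_on_port_edge inner] by (rule card_image)
  ultimately show ?thesis by metis
qed

lemma alternating_2_factor_of_matching:
  assumes M: "perfect_matching (gadget_graph G port H) M"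
  shows "\<exists>F. alternating_2_factor G F \<and> card F = card (M \<inter> E2 G port)"
proof -
  \<comment> \<open>The edges of \<open>G'\<close> whose copies are matched; by
    \<open>inj_on_port_edge\<close> their number is that of the matching edges in
    \<open>E2\<close>.\<close>
  let ?F = "{e \<in> inner_edges. port_edge G port e \<in> M}"
  have ME: "m \<in> E1 G H \<or> m \<in> E2 G port" if "m \<in> M" for m
    using M that unfolding perfect_matching_def gadget_graph_def by auto
  have Muniq: "m = m'" if "m \<in> M" "m' \<in> M" "v \<in> m" "v \<in> m'" for m m' v
    using M that unfolding perfect_matching_def pairwise_def disjnt_def by blast
  have "alternating_2_factor G ?F"
    unfolding alternating_2_factor_def
  proof (intro conjI ballI)
    show "?F \<subseteq> medges G" by (auto simp: inner_edges_def)
  next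
    fix x
    have "(edges_at G ?F x = {} \<or> card (edges_at G ?F x) = 2) \<and> inj_on (colour G) (edges_at G ?F x)"
    proof (cases "x \<in> V")
      case False
      then have "edges_at G ?F x = {}" by (auto simp: edges_at_def inner_edges_def)
      then show ?thesis by simp
    next
      case True
      let ?L = "colour G ` edges_at G ?F x"
      \<comment> \<open>Edges of equal colour at \<open>x\<close> have copies through the same port,
        and the matching has only one edge there.\<close>
      have inj: "inj_on (colour G) (edges_at G ?F x)"
      proof (rule inj_onI)
        fix e f assume ef: "e \<in> edges_at G ?F x" "f \<in> edges_at G ?F x" "colour G e = colour G f"
        then have "port x (colour G e) \<in> port_edge G port e" "port x (colour G e) \<in> port_edge G port f"
          by (auto simp: port_edge_def edges_at_def)
        then have "port_edge G port e = port_edge G port f"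
          using Muniq ef by (auto simp: edges_at_def)
        then show "e = f" using ef inj_on_port_edge by (auto simp: edges_at_def dest: inj_onD)
      qed
      have Lsub: "?L \<subseteq> colours_at G x"
        using colour_in_colours_at by (auto simp: edges_at_def inner_edges_def)
      have "perfect_matching (sdelete (H x) (port x ` ?L)) (M \<inter> sedges (H x))"
        unfolding perfect_matching_def
      proof (intro conjI)
        \<comment> \<open>A port used by \<open>?F\<close> is already matched by an edge that leaves
          the gadget.\<close>
        have nop: "m \<inter> port x ` ?L = {}" if m: "m \<in> M" "m \<in> sedges (H x)" for m
        proof (rule ccontr)
          assume "m \<inter> port x ` ?L \<noteq> {}"
          then obtain e where e: "e \<in> ?F" "x \<in> ends G e" "port x (colour G e) \<in> m"
            by (auto simp: edges_at_def)
          then have "port x (colour G e) \<in> port_edge G port e" by (auto simp: port_edge_def)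
          then have "m = port_edge G port e" using Muniq m e by blast
          then show False using port_edge_not_in_gadget True e gadget_edge(1)[OF True m(2)] by blast
        qed
        then show "M \<inter> sedges (H x) \<subseteq> sedges (sdelete (H x) (port x ` ?L))"
          by (auto simp: sdelete_def)
        show "pairwise disjnt (M \<inter> sedges (H x))"
          using M unfolding perfect_matching_def by (auto simp: pairwise_def)
        show "\<Union>(M \<inter> sedges (H x)) = sverts (sdelete (H x) (port x ` ?L))"
        proof
          show "\<Union>(M \<inter> sedges (H x)) \<subseteq> sverts (sdelete (H x) (port x ` ?L))"
            using nop gadget_edge(1)[OF True] by (fastforce simp: sdelete_def)
          show "sverts (sdelete (H x) (port x ` ?L)) \<subseteq> \<Union>(M \<inter> sedges (H x))"
          proof
            fix v assume "v \<in> sverts (sdelete (H x) (port x ` ?L))"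
            then have v: "v \<in> sverts (H x)" "v \<notin> port x ` ?L" by (auto simp: sdelete_def)
            have "\<Union>M = (\<Union>x\<in>V. sverts (H x))"
              using M unfolding perfect_matching_def gadget_graph_def by simp
            then have "v \<in> \<Union>M" using True v(1) by auto
            then obtain m where m: "m \<in> M" "v \<in> m" by blast
            show "v \<in> \<Union>(M \<inter> sedges (H x))"
            \<comment> \<open>The matching edge at \<open>v\<close> lies in this gadget: one in
              another gadget would miss \<open>v\<close>, and one in \<open>E2\<close> would make
              \<open>v\<close> a used port.\<close>
            proof (cases "m \<in> E1 G H")
              case E1: True
              then obtain y where y: "y \<in> V" "m \<in> sedges (H y)" unfolding E1_def by blast
              then have "y = x" using gadget_unique gadget_edge(1) True v m by blast
              then show ?thesis using y m by blast
            next
              case False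
              then obtain e where e: "e \<in> inner_edges" "m = port_edge G port e"
                using ME m E2_eq by blast
              then have "x \<in> ends G e \<and> v = port x (colour G e)"
                using port_edge_in_gadget m v True by blast
              then have "v \<in> port x ` ?L" using e m by (auto simp: edges_at_def)
              then show ?thesis using v by blast
            qed
          qed
        qed
      qed
      from P_gadget_matching_size[OF P_gadget[OF True] finite_colours_at _ Lsub this]
      have "?L = {} \<or> card ?L = 2"
        using nondegenerate True unfolding nondegenerate_def by blast
      then show ?thesis using inj by (simp add: card_image)
    qed
    then show "edges_at G ?F x = {} \<or> card (edges_at G ?F x) = 2"
      "inj_on (colour G) (edges_at G ?F x)" by blast+
  qed
  moreover have "M \<inter> E2 G port = port_edge G port ` ?F" unfolding E2_eq by blast
  moreover have "card (port_edge G port ` ?F) = card ?F"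
    by (rule card_image, rule inj_on_subset[OF inj_on_port_edge]) blast
  ultimately show ?thesis by metis
qed

end

theorem theorem4p1:
  fixes G :: "('v, 'e) cmgraph" and c r :: nat
    and port :: "'v \<Rightarrow> nat \<Rightarrow> 'w" and H :: "'v \<Rightarrow> 'w sgraph"
  assumes "edge_coloured_multigraph c G" and "mconnected G"
    and "mverts (reduced G) \<noteq> {}"
    and "gadget_choice G port H"
    and "nondegenerate G port H"
  shows "(\<exists>C. pc_cycle_subgraph G C \<and> card (snd C) = r) \<longleftrightarrow>
         (\<exists>M. perfect_matching (gadget_graph G port H) M \<and> card (M \<inter> E2 G port) = r)"
proof -
  interpret P_gadget_graph c G port H using assms by unfold_locales
  \<comment> \<open>Both sides amount to an \<open>alternating_2_factor\<close> with
    \<open>r\<close> edges.\<close>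
  show ?thesis
    using pc_cycle_subgraph_alternating matching_of_alternating_2_factor
      alternating_2_factor_of_matching alternating_2_factor_pc_cycle_subgraph[OF assms(1)]
    by metis
qed

end
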